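(* The generating function $D_1(x)=\sum_{n\ge 0} d_n^{\#1}x^n$ of the sequence $\{d_n^{\#1}\}_{n\geq0}$ is $$D_1(x)= \frac{4-3\sqrt{1-8x}-2\sqrt{3-4x-2\sqrt{1-8x}}-6x+\sqrt{1-8x}\,\sqrt{3-4x-2\sqrt{1-8x}}}{2}.$$
   Context: The m-implication of type 1 is the connective $\psi\rightharpoonup\phi\equiv\psi\to\neg\phi$, which has value 0 (false) exactly when $\psi$ and $\phi$ both have value 1 (true), and value 1 otherwise. A bracketed formula with $n$ distinct variables is obtained from $p_1\rightharpoonup p_2\rightharpoonup\cdots\rightharpoonup p_n$ (variables in this fixed order) by fully inserting brackets; for $n\ge2$ it has the form $\psi\rightharpoonup\phi$ with $\psi$ a bracketing of $p_1\rightharpoonup\cdots\rightharpoonup p_i$ and $\phi$ a bracketing of $p_{i+1}\rightharpoonup\cdots\rightharpoonup p_n$ for some $1\le i\le n-1$. A row is a pair consisting of a bracketed formula and a valuation of $p_1,\dots,p_n$ in $\{0,1\}$. For $n\ge 2$, $d_n^{\#1}$ is the number of rows (over all bracketed formulae in $n$ variables) for which $\psi$ and $\phi$ both have value 0 (so that $\psi\rightharpoonup\phi$ is true); $d_0^{\#1}=d_1^{\#1}=0$. Square roots denote formal power series with positive constant term. *)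

theory Defs
  imports Complex_Main "HOL-Library.FuncSet" "HOL-Computational_Algebra.Formal_Power_Series"
begin

datatype form = Var nat | MImp form form (infixr \<open>\<rightharpoonup>\<close> 65)

primrec val :: "(nat \<Rightarrow> bool) \<Rightarrow> form \<Rightarrow> bool" where
  "val v (Var i) = v i"
| "val v (\<psi> \<rightharpoonup> \<phi>) = (val v \<psi> \<longrightarrow> \<not> val v \<phi>)"

text \<open>\<open>bracketing i j \<chi>\<close>: the formula \<open>\<chi>\<close> arises from \<open>p\<^sub>i \<rightharpoonup> \<dots> \<rightharpoonup> p\<^sub>j\<close> by fully
  inserting brackets.\<close>

inductive bracketing :: "nat \<Rightarrow> nat \<Rightarrow> form \<Rightarrow> bool" where
  single: "bracketing i i (Var i)"
| split: "\<lbrakk>i \<le> k; k < j; bracketing i k \<psi>; bracketing (k + 1) j \<phi>\<rbrakk>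
    \<Longrightarrow> bracketing i j (\<psi> \<rightharpoonup> \<phi>)"

text \<open>Valuations are extensional functions on \<open>{1..n}\<close>, so that each of the \<open>2 ^ n\<close> assignments
  to the variables is counted once.\<close>

definition rows :: "nat \<Rightarrow> (form \<times> (nat \<Rightarrow> bool)) set" where
  "rows n = {\<chi>. bracketing 1 n \<chi>} \<times> ({1..n} \<rightarrow>\<^sub>E UNIV)"

definition d1 :: "nat \<Rightarrow> nat" where
  "d1 n = (if n < 2 then 0 else
     card {(\<chi>, v) \<in> rows n. \<exists>\<psi> \<phi>. \<chi> = \<psi> \<rightharpoonup> \<phi> \<and> \<not> val v \<psi> \<and> \<not> val v \<phi>})"

definition D1 :: "real fps" where
  "D1 = Abs_fps (\<lambda>n. real (d1 n))"

definition fps_sqrt :: "real fps \<Rightarrow> real fps" where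
  "fps_sqrt f = fps_radical root 2 f"

text \<open>If \<open>f\<close> has positive constant term, then \<open>fps_sqrt f\<close> is the unique square root of \<open>f\<close>
  with positive constant term.\<close>

lemma fps_sqrt_square:
  assumes "fps_nth f 0 > 0"
  shows "(fps_sqrt f)\<^sup>2 = f" and "fps_nth (fps_sqrt f) 0 > 0"
proof -
  have "(root (Suc 1) (fps_nth f 0)) ^ Suc 1 = fps_nth f 0"
    using assms by (intro real_root_pow_pos2) auto
  then show "(fps_sqrt f)\<^sup>2 = f"
    using power_radical[of f root 1] assms
    by (simp add: fps_sqrt_def numeral_2_eq_2)
  show "fps_nth (fps_sqrt f) 0 > 0"
    using assms by (simp add: fps_sqrt_def numeral_2_eq_2)
qed

lemma fps_sqrt_unique:
  assumes "g\<^sup>2 = f" "fps_nth g 0 > 0"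
  shows "fps_sqrt f = g"
proof -
  have f: "fps_nth f 0 > 0"
    using assms by (auto simp: power2_eq_square)
  have "(fps_sqrt f - g) * (fps_sqrt f + g) = 0"
    using fps_sqrt_square(1)[OF f] assms(1) by (simp add: algebra_simps power2_eq_square)
  moreover have "fps_nth (fps_sqrt f + g) 0 \<noteq> 0"
    using fps_sqrt_square(2)[OF f] assms(2) by simp
  then have "fps_sqrt f + g \<noteq> 0"
    by (metis fps_zero_nth)
  ultimately show ?thesis by simp
qed

end

theory Submission imports Defs begin

text \<open>Let \<open>F\<close> and \<open>T\<close> be the generating functions of the false and the true rows. Splitting a row at
  its main connective gives \<open>F = x + T\<^sup>2\<close> and \<open>T = x + F\<^sup>2 + 2FT\<close>, while the rows to be counted
  have generating function \<open>F\<^sup>2\<close>. The sum \<open>G = F + T\<close> satisfies \<open>G = 2x + G\<^sup>2\<close>, so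
  \<open>\<surd>(1 - 8x) = 1 - 2G\<close>; then \<open>F = x + (G - F)\<^sup>2\<close> gives \<open>\<surd>(3 - 4x - 2\<surd>(1 - 8x)) = 1 + 2G - 2F\<close>.\<close>

section \<open>Structure of bracketings\<close>

text \<open>Here \<open>size\<close> counts the connectives, since variables have size 0. Hence the
  left subformula alone determines where a bracketing is split.\<close>

lemma bracketing_end: "bracketing i j \<chi> \<Longrightarrow> j = i + size \<chi>"
  by (induction rule: bracketing.induct) auto

lemma bracketing_le: "bracketing i j \<chi> \<Longrightarrow> i \<le> j"
  by (auto dest: bracketing_end)

lemma bracketing_MImp_iff:
  "bracketing i j (\<psi> \<rightharpoonup> \<phi>) \<longleftrightarrow> (\<exists>k\<in>{i..<j}. bracketing i k \<psi> \<and> bracketing (k + 1) j \<phi>)"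
  by (subst bracketing.simps) auto

lemma bracketing_Var_iff: "bracketing i j (Var n) \<longleftrightarrow> i = n \<and> j = n"
  by (subst bracketing.simps) auto

text \<open>Only variables with index in the interval occur in \<open>\<chi>\<close>. This lets a
  valuation be cut at the split point without changing the values of the two subformulae.\<close>

lemma val_cong:
  "bracketing i j \<chi> \<Longrightarrow> (\<And>x. x \<in> {i..j} \<Longrightarrow> v x = w x) \<Longrightarrow> val v \<chi> = val w \<chi>"
  by (induction rule: bracketing.induct) (auto dest: bracketing_le)

text \<open>Induction on the length of the interval: both parts of a split span strictly shorter
  intervals.\<close>

lemma finite_bracketing: "finite {\<chi>. bracketing i j \<chi>}"
proof (induction "j - i" arbitrary: i j rule: less_induct)
  case less
  have "{\<chi>. bracketing i j \<chi>} \<subseteq> {Var i} \<union>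
    (\<Union>k\<in>{i..<j}. case_prod MImp ` ({\<psi>. bracketing i k \<psi>} \<times> {\<phi>. bracketing (k + 1) j \<phi>}))"
  proof
    fix \<chi> assume "\<chi> \<in> {\<chi>. bracketing i j \<chi>}"
    then show "\<chi> \<in> {Var i} \<union> (\<Union>k\<in>{i..<j}. case_prod MImp `
        ({\<psi>. bracketing i k \<psi>} \<times> {\<phi>. bracketing (k + 1) j \<phi>}))"
      by (cases \<chi>) (force simp: bracketing_Var_iff bracketing_MImp_iff)+
  qed
  moreover have "finite {\<psi>. bracketing i k \<psi>}" "finite {\<phi>. bracketing (k + 1) j \<phi>}"
    if "k \<in> {i..<j}" for k
    using that by (intro less; auto)+
  ultimately show ?case
    by (elim finite_subset) auto
qed

section \<open>Splitting rows at the main connective\<close>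

text \<open>The left endpoint is kept general because the right subformula of a row does not start
  at the first variable.\<close>

definition rows_val :: "bool \<Rightarrow> nat \<Rightarrow> nat \<Rightarrow> (form \<times> (nat \<Rightarrow> bool)) set" where
  "rows_val b i j = {(\<chi>, v). bracketing i j \<chi> \<and> v \<in> {i..j} \<rightarrow>\<^sub>E UNIV \<and> val v \<chi> = b}"

definition rows_split :: "bool \<Rightarrow> bool \<Rightarrow> nat \<Rightarrow> nat \<Rightarrow> (form \<times> (nat \<Rightarrow> bool)) set" where
  "rows_split c d i j = {(\<psi> \<rightharpoonup> \<phi>, v) | \<psi> \<phi> v.
     bracketing i j (\<psi> \<rightharpoonup> \<phi>) \<and> v \<in> {i..j} \<rightarrow>\<^sub>E UNIV \<and> val v \<psi> = c \<and> val v \<phi> = d}"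

lemma finite_rows: "finite ({\<chi>. bracketing i j \<chi>} \<times> ({i..j} \<rightarrow>\<^sub>E (UNIV :: bool set)))"
  by (intro finite_cartesian_product finite_bracketing finite_PiE) auto

lemma finite_rows_split: "finite (rows_split c d i j)"
  by (rule finite_subset[OF _ finite_rows[of i j]]) (auto simp: rows_split_def)

lemma finite_rows_val: "finite (rows_val b i j)"
  by (rule finite_subset[OF _ finite_rows[of i j]]) (auto simp: rows_val_def)

lemma rows_val_eq_empty: "j < i \<Longrightarrow> rows_val b i j = {}"
  by (auto simp: rows_val_def dest: bracketing_le)

lemma card_rows_val_single: "card (rows_val b i i) = 1"
proof -
  have "bracketing i i \<chi> \<longleftrightarrow> \<chi> = Var i" for \<chi>
    by (cases \<chi>) (auto simp: bracketing_Var_iff bracketing_MImp_iff)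
  moreover have "v \<in> {i..i} \<rightarrow>\<^sub>E UNIV \<and> v i = b \<longleftrightarrow> v = (\<lambda>x\<in>{i}. b)" for v
    by (auto simp: PiE_iff intro: extensionalityI[of _ "{i}"])
  ultimately have "rows_val b i i = {(Var i, \<lambda>x\<in>{i}. b)}"
    unfolding rows_val_def by (auto cong: conj_cong)
  then show ?thesis by simp
qed

text \<open>The variables of the two subformulae are disjoint and together fill
  \<open>{i..j}\<close>, so a row split at \<open>k\<close> amounts to an independent pair of
  rows.\<close>

lemma card_rows_split_at:
  assumes "k \<in> {i..<j}"
  shows "card {(\<psi> \<rightharpoonup> \<phi>, v) | \<psi> \<phi> v. bracketing i k \<psi> \<and> bracketing (k + 1) j \<phi> \<and>
           v \<in> {i..j} \<rightarrow>\<^sub>E UNIV \<and> val v \<psi> = c \<and> val v \<phi> = d}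
       = card (rows_val c i k) * card (rows_val d (k + 1) j)" (is "card ?A = _")
proof -
  \<comment> \<open>\<open>f\<close> joins two rows by gluing their valuations at \<open>k\<close>;
    \<open>g\<close> cuts them apart again. The \<open>undefined\<close> branch is never reached on
    \<open>?A\<close>, which contains implications only.\<close>
  define f where "f = (\<lambda>((\<psi>, u), (\<phi>, w)).
    (\<psi> \<rightharpoonup> \<phi>, \<lambda>x\<in>{i..j}. if x \<le> k then u x else (w x :: bool)))"
  define g where "g = (\<lambda>(\<chi>, v). case \<chi> of
      \<psi> \<rightharpoonup> \<phi> \<Rightarrow> ((\<psi>, restrict v {i..k}), (\<phi>, restrict v {k + 1..j} :: nat \<Rightarrow> bool))
    | Var n \<Rightarrow> undefined)"
  have vf: "val (\<lambda>x\<in>{i..j}. if x \<le> k then u x else w x) \<psi> = val u \<psi>"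
    if "bracketing i k \<psi>" for \<psi> u w
    by (rule val_cong[OF that]) (use assms in auto)
  have vf': "val (\<lambda>x\<in>{i..j}. if x \<le> k then u x else w x) \<phi> = val w \<phi>"
    if "bracketing (k + 1) j \<phi>" for \<phi> u w
    by (rule val_cong[OF that]) (use assms in auto)
  have vg: "val (restrict v {l..m}) \<psi> = val v \<psi>" if "bracketing l m \<psi>" for \<psi> v l m
    by (rule val_cong[OF that]) auto
  \<comment> \<open>Extensionality fixes the values outside the respective intervals, so cutting and
    gluing are inverse as functions, not merely on the relevant variables.\<close>
  have gf: "restrict (\<lambda>x\<in>{i..j}. if x \<le> k then u x else w x) {i..k} = u"
      "restrict (\<lambda>x\<in>{i..j}. if x \<le> k then u x else w x) {k + 1..j} = w"
    if "u \<in> {i..k} \<rightarrow>\<^sub>E UNIV" "w \<in> {k + 1..j} \<rightarrow>\<^sub>E UNIV" for u w :: "nat \<Rightarrow> bool"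
  proof -
    have "u \<in> extensional {i..k}" "w \<in> extensional {k + 1..j}"
      using that by (auto simp: PiE_def)
    then show "restrict (\<lambda>x\<in>{i..j}. if x \<le> k then u x else w x) {i..k} = u"
        "restrict (\<lambda>x\<in>{i..j}. if x \<le> k then u x else w x) {k + 1..j} = w"
      using assms by (auto intro!: extensionalityI[OF restrict_extensional])
  qed
  have fg: "(\<lambda>x\<in>{i..j}. if x \<le> k then restrict v {i..k} x else restrict v {Suc k..j} x) = v"
    if "v \<in> {i..j} \<rightarrow>\<^sub>E UNIV" for v :: "nat \<Rightarrow> bool"
  proof -
    have "v \<in> extensional {i..j}"
      using that by (auto simp: PiE_def)
    then show ?thesis
      by (auto intro!: extensionalityI[OF restrict_extensional])
  qed
  have "bij_betw f (rows_val c i k \<times> rows_val d (k + 1) j) ?A"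
  proof (rule bij_betw_byWitness[where f' = g])
    show "\<forall>a\<in>rows_val c i k \<times> rows_val d (k + 1) j. g (f a) = a"
      by (clarsimp simp: f_def g_def rows_val_def gf[simplified])
    show "\<forall>a\<in>?A. f (g a) = a"
      by (clarsimp simp: f_def g_def fg simp del: restrict_apply restrict_apply' split del: if_split)
    show "f ` (rows_val c i k \<times> rows_val d (k + 1) j) \<subseteq> ?A"
      using vf vf'
      by (auto simp: f_def rows_val_def simp del: restrict_apply restrict_apply' split del: if_split)
    show "g ` ?A \<subseteq> rows_val c i k \<times> rows_val d (k + 1) j"
      using vg by (auto simp: g_def rows_val_def)
  qed
  from bij_betw_same_card[OF this] show ?thesis
    by (simp only: card_cartesian_product)
qed

lemma card_rows_split:
  "card (rows_split c d i j) = (\<Sum>k=i..<j. card (rows_val c i k) * card (rows_val d (k + 1) j))"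
proof -
  define A where "A k = {(\<psi> \<rightharpoonup> \<phi>, v) | \<psi> \<phi> v. bracketing i k \<psi> \<and> bracketing (k + 1) j \<phi> \<and>
           v \<in> {i..j} \<rightarrow>\<^sub>E UNIV \<and> val v \<psi> = c \<and> val v \<phi> = d}" for k
  have eq: "rows_split c d i j = (\<Union>k\<in>{i..<j}. A k)"
    unfolding rows_split_def A_def bracketing_MImp_iff by blast
  have "card (rows_split c d i j) = (\<Sum>k=i..<j. card (A k))"
    unfolding eq
  proof (rule card_UN_disjoint)
    show "\<forall>k\<in>{i..<j}. finite (A k)"
      using finite_rows_split[of c d i j] unfolding eq by (auto intro: finite_subset)
    \<comment> \<open>The split index equals \<open>i + size \<psi>\<close>, so no row is split at
      two different indices.\<close>
    show "\<forall>k\<in>{i..<j}. \<forall>l\<in>{i..<j}. k \<noteq> l \<longrightarrow> A k \<inter> A l = {}"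
      unfolding A_def by (auto dest!: bracketing_end)
  qed auto
  also have "\<dots> = (\<Sum>k=i..<j. card (rows_val c i k) * card (rows_val d (k + 1) j))"
    unfolding A_def by (intro sum.cong refl card_rows_split_at)
  finally show ?thesis .
qed

text \<open>With at least two variables every bracketing is an implication, and each row determines
  its pair \<open>(c, d)\<close>, so the union over these pairs is disjoint.\<close>

lemma card_rows_val:
  assumes "i < j"
  shows "card (rows_val b i j) = (\<Sum>(c, d) | (c \<longrightarrow> \<not> d) = b. card (rows_split c d i j))"
proof -
  have "rows_val b i j = (\<Union>(c, d)\<in>{(c, d). (c \<longrightarrow> \<not> d) = b}. rows_split c d i j)"
  proof -
    have "\<chi> \<noteq> Var n" if "bracketing i j \<chi>" for \<chi> n
      using that assms by (auto simp: bracketing_Var_iff)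
    then have "\<exists>\<psi> \<phi>. \<chi> = \<psi> \<rightharpoonup> \<phi>" if "bracketing i j \<chi>" for \<chi>
      using that by (cases \<chi>) auto
    then show ?thesis
      unfolding rows_val_def rows_split_def by fastforce
  qed
  then show ?thesis
    by (simp only:, subst card_UN_disjoint)
      (simp_all add: split_beta finite_rows_split, auto simp: rows_split_def)
qed

section \<open>Translation invariance and convolution\<close>

definition row_count :: "bool \<Rightarrow> nat \<Rightarrow> nat" where
  "row_count b n = card (rows_val b 1 n)"

text \<open>No renaming of variables is needed: the counts for shifted intervals obey the same
  recursion with the same initial values, so strong induction on \<open>n\<close> identifies
  them.\<close>

lemma card_rows_val_shift: "card (rows_val b (m + 1) (m + n)) = row_count b n"
  unfolding row_count_def
proof (induction n arbitrary: b m rule: less_induct)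
  case (less n)
  consider "n = 0" | "n = 1" | "n > 1" by linarith
  then show ?case
  proof cases
    case 3
    have "card (rows_split c d (m + 1) (m + n)) = card (rows_split c d 1 n)" for c d
    proof -
      \<comment> \<open>The right endpoint \<open>m + n\<close> is written as
        \<open>m + k + (n - k)\<close> to exhibit the right factor as an interval of length
        \<open>n - k\<close> shifted by \<open>m + k\<close>.\<close>
      have "card (rows_split c d (m + 1) (m + n)) =
        (\<Sum>k=1..<n. card (rows_val c (m + 1) (m + k)) * card (rows_val d (m + k + 1) (m + k + (n - k))))"
        unfolding card_rows_split
        by (rule sum.reindex_bij_witness[of _ "\<lambda>k. m + k" "\<lambda>k. k - m"]) (auto simp: add.commute)
      also have "\<dots> = (\<Sum>k=1..<n. card (rows_val c 1 k) * card (rows_val d (k + 1) (k + (n - k))))"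
      proof (intro sum.cong refl)
        fix k assume "k \<in> {1..<n}"
        then have "k < n" "n - k < n" by auto
        then show "card (rows_val c (m + 1) (m + k)) * card (rows_val d (m + k + 1) (m + k + (n - k)))
            = card (rows_val c 1 k) * card (rows_val d (k + 1) (k + (n - k)))"
          using less[of k c m] less[of "n - k" d "m + k"] less[of "n - k" d k] by simp
      qed
      finally show ?thesis
        unfolding card_rows_split by simp
    qed
    then show ?thesis
      using 3 by (simp add: card_rows_val)
  qed (simp_all add: rows_val_eq_empty card_rows_val_single[simplified])
qed

lemma row_count_0: "row_count b 0 = 0"
  by (simp add: row_count_def rows_val_eq_empty)

lemma card_rows_split_convolution:
  "card (rows_split c d 1 n) = (\<Sum>k=0..n. row_count c k * row_count d (n - k))"
proof -
  have "card (rows_split c d 1 n) = (\<Sum>k=1..<n. row_count c k * row_count d (n - k))"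
    unfolding card_rows_split
  proof (intro sum.cong refl)
    fix k assume "k \<in> {1..<n}"
    then show "card (rows_val c 1 k) * card (rows_val d (k + 1) n) = row_count c k * row_count d (n - k)"
      using card_rows_val_shift[of d k "n - k"] by (simp add: row_count_def)
  qed
  \<comment> \<open>The added terms \<open>k = 0\<close> and \<open>k = n\<close> contain a factor
    \<open>row_count _ 0 = 0\<close>.\<close>
  also have "\<dots> = (\<Sum>k=0..n. row_count c k * row_count d (n - k))"
    by (rule sum.mono_neutral_left) (auto simp: row_count_0 not_less_eq_eq le_less)
  finally show ?thesis .
qed

section \<open>Generating functions\<close>

definition row_fps :: "bool \<Rightarrow> real fps" where
  "row_fps b = Abs_fps (\<lambda>n. real (row_count b n))"

lemma row_fps_mult_nth: "fps_nth (row_fps c * row_fps d) n = real (card (rows_split c d 1 n))"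
  by (simp add: card_rows_split_convolution fps_mult_nth row_fps_def del: One_nat_def)

text \<open>The term \<open>fps_X\<close> is the single variable, which has one row of each value;
  all longer formulae arise from a split, and the products contribute nothing below degree
  2.\<close>

lemma row_fps_eq: "row_fps b = fps_X + (\<Sum>(c, d) | (c \<longrightarrow> \<not> d) = b. row_fps c * row_fps d)"
proof (rule fps_ext)
  fix n :: nat
  consider "n = 0" | "n = 1" | "n > 1" by linarith
  then show "fps_nth (row_fps b) n =
    fps_nth (fps_X + (\<Sum>(c, d) | (c \<longrightarrow> \<not> d) = b. row_fps c * row_fps d)) n"
  proof cases
    case 1
    then show ?thesis
      by (simp add: fps_sum_nth split_beta row_fps_def row_count_0)
  next
    case 2
    then show ?thesis
      using card_rows_val_single[of b 1]
      by (simp add: fps_sum_nth split_beta row_fps_def row_count_def rows_val_eq_empty)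
  next
    case 3
    then have "fps_nth (row_fps b) n = (\<Sum>(c, d) | (c \<longrightarrow> \<not> d) = b. real (card (rows_split c d 1 n)))"
      by (simp add: row_fps_def row_count_def card_rows_val split_beta)
    then show ?thesis
      using 3 by (simp add: fps_sum_nth split_beta row_fps_mult_nth)
  qed
qed

lemma row_fps_False: "row_fps False = fps_X + (row_fps True)\<^sup>2"
proof -
  have "{(c, d). (c \<longrightarrow> \<not> d) = False} = {(True, True)}" by auto
  then show ?thesis
    by (subst row_fps_eq) (simp add: power2_eq_square)
qed

lemma row_fps_True:
  "row_fps True = fps_X + (row_fps False)\<^sup>2 + 2 * row_fps False * row_fps True"
proof -
  have "{(c, d). (c \<longrightarrow> \<not> d) = True} = {(False, False), (False, True), (True, False)}" by auto
  then show ?thesis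
    by (subst row_fps_eq) (simp add: power2_eq_square algebra_simps)
qed

lemma D1_eq: "D1 = (row_fps False)\<^sup>2"
proof (rule fps_ext)
  fix n :: nat
  have "{(\<chi>, v) \<in> rows n. \<exists>\<psi> \<phi>. \<chi> = \<psi> \<rightharpoonup> \<phi> \<and> \<not> val v \<psi> \<and> \<not> val v \<phi>} = rows_split False False 1 n"
    by (auto simp: rows_def rows_split_def)
  \<comment> \<open>This agrees with the convention that \<open>d1\<close> vanishes at 0 and
    1.\<close>
  moreover have "card (rows_split False False 1 n) = 0" if "n < 2"
    using that by (simp add: card_rows_split)
  ultimately show "fps_nth D1 n = fps_nth ((row_fps False)\<^sup>2) n"
    by (simp add: D1_def d1_def power2_eq_square row_fps_mult_nth del: One_nat_def)
qed

theorem proposition6p8: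
  "D1 =
    (4 - 3 * fps_sqrt (1 - 8 * fps_X)
       - 2 * fps_sqrt (3 - 4 * fps_X - 2 * fps_sqrt (1 - 8 * fps_X))
       - 6 * fps_X
       + fps_sqrt (1 - 8 * fps_X) * fps_sqrt (3 - 4 * fps_X - 2 * fps_sqrt (1 - 8 * fps_X))) / 2"
proof -
  define F T where "F = row_fps False" and "T = row_fps True"
  have F: "F = fps_X + T\<^sup>2" and T: "T = fps_X + F\<^sup>2 + 2 * F * T"
    unfolding F_def T_def by (rule row_fps_False row_fps_True)+
  \<comment> \<open>Both candidate roots below therefore have constant term 1, which selects the
    positive branch.\<close>
  have nth0: "fps_nth F 0 = 0" "fps_nth T 0 = 0"
    by (simp_all add: F_def T_def row_fps_def row_count_0)
  have s: "fps_sqrt (1 - 8 * fps_X) = 1 - 2 * (F + T)"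
  proof (rule fps_sqrt_unique)
    show "(1 - 2 * (F + T))\<^sup>2 = 1 - 8 * fps_X"
      using F T by algebra
  qed (simp add: nth0)
  have r: "fps_sqrt (3 - 4 * fps_X - 2 * (1 - 2 * (F + T))) = 1 + 2 * T"
  proof (rule fps_sqrt_unique)
    show "(1 + 2 * T)\<^sup>2 = 3 - 4 * fps_X - 2 * (1 - 2 * (F + T))"
      using F by algebra
  qed (simp add: nth0)
  \<comment> \<open>The left side expands to
    \<open>4 * F + 2 * T - 6 * fps_X - 4 * F * T - 4 * T\<^sup>2\<close>. Replacing
    \<open>T\<^sup>2\<close> by \<open>F - fps_X\<close> leaves
    \<open>2 * (T - fps_X - 2 * F * T)\<close>, which is \<open>2 * F\<^sup>2\<close> by the
    equation for \<open>T\<close>.\<close>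
  have "4 - 3 * (1 - 2 * (F + T)) - 2 * (1 + 2 * T) - 6 * fps_X + (1 - 2 * (F + T)) * (1 + 2 * T)
      = 2 * F\<^sup>2"
    using F T by algebra
  then show ?thesis
    unfolding s r D1_eq F_def[symmetric] by simp
qed

end
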